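(* The recoverable robust selection problem \textsc{RREC} under the discrete budgeted uncertainty set $\mathcal{U}^d$, i.e. $\min_{\mathbf{x}\in\Phi}\big(\mathbf{C}\mathbf{x}+\max_{\mathbf{c}\in\mathcal{U}^d}\min_{\mathbf{y}\in\Phi^k_{\mathbf{x}}}\mathbf{c}\mathbf{y}\big)$, is equivalent (same optimal value, and the $\mathbf{x}$-part of an optimal solution is an optimal solution to \textsc{RREC}) to the following program, where $\mathcal{S}=\{(\alpha^1,\beta^1),\dots,(\alpha^S,\beta^S)\}$ is the finite set defined in the context: $$\begin{array}{lll} \min & \lambda\\ \text{s.t.} & \lambda\ge\sum_{i\in[n]}C_ix_i+\Gamma\pi^\ell+\sum_{i\in[n]}\rho^\ell_i+p\alpha^\ell+(p-k)\beta^\ell-\sum_{i\in[n]}[\alpha^\ell+x_i\beta^\ell-\underline{c}_i]_+ & \ell\in[S]\\ & \pi^\ell+\rho^\ell_i\ge[\alpha^\ell+x_i\beta^\ell-\underline{c}_i]_+-[\alpha^\ell+x_i\beta^\ell-\underline{c}_i-d_i]_+ & i\in[n],\ \ell\in[S]\\ & \sum_{i\in[n]}x_i=p\\ & x_i\in\{0,1\} & i\in[n]\\ & \rho^\ell_i\ge 0,\ \pi^\ell\ge 0 & i\in[n],\ \ell\in[S]. \end{array}$$ After replacing each term $[a+bx_i]_+$ ($a,b$ constants) by $[a]_++([a+b]_+-[a]_+)x_i$, this is a mixed integer linear program with $O(n^3)$ variables and $O(n^3)$ constraints.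
   Context: Let $[n]=\{1,\dots,n\}$, $p\in[n]$, $k\in[p]\cup\{0\}$ a recovery parameter, $\mathbf{C}=(C_1,\dots,C_n)$ a vector of first-stage costs, $0\le\underline{c}_i\le\overline{c}_i$ and $d_i=\overline{c}_i-\underline{c}_i$ for $i\in[n]$, and $\Gamma$ a nonnegative integer. $[a]_+=\max\{0,a\}$ and $\mathbf{c}\mathbf{y}=\sum_{i\in[n]}c_iy_i$. $\Phi=\{\mathbf{x}\in\{0,1\}^n:\sum_{i\in[n]}x_i=p\}$. For $\mathbf{x}\in\Phi$, $\Phi^k_{\mathbf{x}}=\{\mathbf{y}\in\{0,1\}^n:\sum_{i\in[n]}y_i=p,\ \sum_{i\in[n]}x_iy_i\ge p-k\}$. $\mathcal{U}^d=\{(\underline{c}_i+\delta_i)_{i\in[n]}:\delta_i\in\{0,d_i\},\ |\{i\in[n]:\delta_i=d_i\}|\le\Gamma\}$. Let $\underline{\sigma},\overline{\sigma}$ be permutations of $[n]$ with $\underline{c}_{\underline{\sigma}(1)}\le\dots\le\underline{c}_{\underline{\sigma}(n)}$ and $\overline{c}_{\overline{\sigma}(1)}\le\dots\le\overline{c}_{\overline{\sigma}(n)}$. Define $$\mathcal{C}_{\sigma(p)}=\{\underline{c}_{\underline{\sigma}(p)},\dots,\underline{c}_{\underline{\sigma}(p+\Gamma)}\}\cup\{\overline{c}_{\overline{\sigma}(1)},\dots,\overline{c}_{\overline{\sigma}(p)}\},$$ $$\mathcal{C}_{\sigma(p-k)}=\{\underline{c}_{\underline{\sigma}(p-k)},\dots,\underline{c}_{\underline{\sigma}(n-k+\Gamma)}\}\cup\{\overline{c}_{\overline{\sigma}(1)},\dots,\overline{c}_{\overline{\sigma}(n-k)}\},$$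 $$\mathcal{C}_{\sigma(k)}=\{\underline{c}_{\underline{\sigma}(k)},\dots,\underline{c}_{\underline{\sigma}(k+p+\Gamma)}\}\cup\{\overline{c}_{\overline{\sigma}(1)},\dots,\overline{c}_{\overline{\sigma}(k+p)}\}.$$ Here an index larger than $n$ is replaced by $n$, and in the sets of lower bounds $\underline{c}$ the index $0$ is replaced by $1$; a list $\overline{c}_{\overline{\sigma}(1)},\dots,\overline{c}_{\overline{\sigma}(0)}$ is empty. Finally $$\mathcal{S}=\{(u,0):u\in\mathcal{C}_{\sigma(p)},\ \text{there is } v\in\mathcal{C}_{\sigma(p-k)}\text{ with } v\le u\}\ \cup\ \{(w,v-w):v\in\mathcal{C}_{\sigma(p-k)},\ w\in\mathcal{C}_{\sigma(k)},\ v>w\},$$ and $S=|\mathcal{S}|$, which is $O(n^2)$.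
   Formalization: In the uncertainty set U^d the budget Γ bounds the number of items with δ_i ≠ 0 rather than with δ_i = d_i; the two agree if all d_i > 0, but with items having d_i = 0 the literal set can be empty (e.g. all d_i = 0, Γ = 0), leaving the maximum undefined. *)

theory Defs
  imports
    Complex_Main
    "HOL-Library.FuncSet"
    "HOL-Library.Landau_Symbols"
    "HOL-Library.Going_To_Filter"
    "HOL-Combinatorics.Permutations"
begin

(* Vectors in R^n are functions nat => real on {1..n}; sets of vectors consist of extensional
   functions, so that {0,1}^n is finite and distinct functions are distinct vectors.
   Besides the instance (n, p, k, Gamma, C, lower and upper costs) the record holds the auxiliary
   data used to write down the program: the two sorting permutations and an enumeration
   (alpha l, beta l), l = 1, ..., S, of the set of breakpoints. *)
record rrs =
  items :: nat
  selsize :: nat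
  recov :: nat
  budget :: nat
  first_cost :: "nat \<Rightarrow> real"
  lo :: "nat \<Rightarrow> real"
  hi :: "nat \<Rightarrow> real"
  perm_lo :: "nat \<Rightarrow> nat"
  perm_hi :: "nat \<Rightarrow> nat"
  alpha :: "nat \<Rightarrow> real"
  beta :: "nat \<Rightarrow> real"

abbreviation Items :: "rrs \<Rightarrow> nat set" where
  "Items D \<equiv> {1..items D}"

definition dev :: "rrs \<Rightarrow> nat \<Rightarrow> real" where
  "dev D i = hi D i - lo D i"

definition pos :: "real \<Rightarrow> real" where
  "pos a = max 0 a"


subsection \<open>The recoverable robust selection problem\<close>

definition Phi :: "rrs \<Rightarrow> (nat \<Rightarrow> real) set" where
  "Phi D = {x \<in> Items D \<rightarrow>\<^sub>E {0, 1}. (\<Sum>i\<in>Items D. x i) = real (selsize D)}"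

definition Phi_recov :: "rrs \<Rightarrow> (nat \<Rightarrow> real) \<Rightarrow> (nat \<Rightarrow> real) set" where
  "Phi_recov D x = {y \<in> Items D \<rightarrow>\<^sub>E {0, 1}. (\<Sum>i\<in>Items D. y i) = real (selsize D) \<and>
     (\<Sum>i\<in>Items D. x i * y i) \<ge> real (selsize D) - real (recov D)}"

(* The budget counts the items whose cost really deviates. Counting the indices with delta i = d i
   literally would also count, in every scenario, all items with d i = 0, and could make
   the uncertainty set empty; if all d i are positive, the two readings agree. *)
definition Ud :: "rrs \<Rightarrow> (nat \<Rightarrow> real) set" where
  "Ud D = {(\<lambda>i\<in>Items D. lo D i + \<delta> i) | \<delta>.
     (\<forall>i\<in>Items D. \<delta> i \<in> {0, dev D i}) \<and> card {i \<in> Items D. \<delta> i \<noteq> 0} \<le> budget D}"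

(* All three optimisations are over finite nonempty sets, so Min and Max are genuine. *)
definition rrec_obj :: "rrs \<Rightarrow> (nat \<Rightarrow> real) \<Rightarrow> real" where
  "rrec_obj D x = (\<Sum>i\<in>Items D. first_cost D i * x i) +
     Max ((\<lambda>c. Min ((\<lambda>y. \<Sum>i\<in>Items D. c i * y i) ` Phi_recov D x)) ` Ud D)"

definition rrec_value :: "rrs \<Rightarrow> real" where
  "rrec_value D = Min (rrec_obj D ` Phi D)"


subsection \<open>The breakpoint set\<close>

definition lo_sorted :: "rrs \<Rightarrow> nat \<Rightarrow> real" where
  "lo_sorted D j = lo D (perm_lo D (max 1 (min (items D) j)))"

definition hi_sorted :: "rrs \<Rightarrow> nat \<Rightarrow> real" where
  "hi_sorted D j = hi D (perm_hi D (min (items D) j))"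

definition C_p :: "rrs \<Rightarrow> real set" where
  "C_p D = lo_sorted D ` {selsize D..selsize D + budget D} \<union> hi_sorted D ` {1..selsize D}"

definition C_pk :: "rrs \<Rightarrow> real set" where
  "C_pk D = lo_sorted D ` {selsize D - recov D..items D - recov D + budget D} \<union>
     hi_sorted D ` {1..items D - recov D}"

definition C_k :: "rrs \<Rightarrow> real set" where
  "C_k D = lo_sorted D ` {recov D..recov D + selsize D + budget D} \<union>
     hi_sorted D ` {1..recov D + selsize D}"

definition breakpoints :: "rrs \<Rightarrow> (real \<times> real) set" where
  "breakpoints D = {(u, 0) | u. u \<in> C_p D \<and> (\<exists>v\<in>C_pk D. v \<le> u)} \<union>
     {(w, v - w) | v w. v \<in> C_pk D \<and> w \<in> C_k D \<and> v > w}"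

abbreviation Points :: "rrs \<Rightarrow> nat set" where
  "Points D \<equiv> {1..card (breakpoints D)}"

definition valid :: "rrs \<Rightarrow> bool" where
  "valid D \<longleftrightarrow>
     selsize D \<in> Items D \<and> recov D \<le> selsize D \<and>
     (\<forall>i\<in>Items D. 0 \<le> lo D i \<and> lo D i \<le> hi D i) \<and>
     perm_lo D permutes Items D \<and> mono_on (Items D) (\<lambda>j. lo D (perm_lo D j)) \<and>
     perm_hi D permutes Items D \<and> mono_on (Items D) (\<lambda>j. hi D (perm_hi D j)) \<and>
     bij_betw (\<lambda>l. (alpha D l, beta D l)) (Points D) (breakpoints D)"


subsection \<open>The program\<close>

datatype prog_var = VLambda | VX nat | VPi nat | VRho nat nat

definition prog_vars :: "rrs \<Rightarrow> prog_var set" where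
  "prog_vars D = {VLambda} \<union> VX ` Items D \<union> VPi ` Points D \<union>
     {VRho i l | i l. i \<in> Items D \<and> l \<in> Points D}"

definition x_part :: "rrs \<Rightarrow> (prog_var \<Rightarrow> real) \<Rightarrow> (nat \<Rightarrow> real)" where
  "x_part D z = (\<lambda>i\<in>Items D. z (VX i))"

definition hinge :: "real \<Rightarrow> real \<Rightarrow> real \<Rightarrow> real" where
  "hinge a b t = pos (a + b * t)"

definition hinge_lin :: "real \<Rightarrow> real \<Rightarrow> real \<Rightarrow> real" where
  "hinge_lin a b t = pos a + (pos (a + b) - pos a) * t"

(* The feasible set of the program in which every term [a + b * x i]_+ is rendered as h a b (x i):
   h = hinge gives the program itself, h = hinge_lin the one obtained by the replacement.
   The program minimises z VLambda. *)
definition prog_feasible :: "rrs \<Rightarrow> (real \<Rightarrow> real \<Rightarrow> real \<Rightarrow> real) \<Rightarrow> (prog_var \<Rightarrow> real) set" where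
  "prog_feasible D h = {z \<in> prog_vars D \<rightarrow>\<^sub>E UNIV.
     (\<forall>l\<in>Points D. z VLambda \<ge>
        (\<Sum>i\<in>Items D. first_cost D i * z (VX i)) + real (budget D) * z (VPi l)
        + (\<Sum>i\<in>Items D. z (VRho i l))
        + real (selsize D) * alpha D l + (real (selsize D) - real (recov D)) * beta D l
        - (\<Sum>i\<in>Items D. h (alpha D l - lo D i) (beta D l) (z (VX i)))) \<and>
     (\<forall>i\<in>Items D. \<forall>l\<in>Points D. z (VPi l) + z (VRho i l) \<ge>
        h (alpha D l - lo D i) (beta D l) (z (VX i))
        - h (alpha D l - lo D i - dev D i) (beta D l) (z (VX i))) \<and>
     (\<Sum>i\<in>Items D. z (VX i)) = real (selsize D) \<and>
     (\<forall>i\<in>Items D. z (VX i) \<in> {0, 1}) \<and>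
     (\<forall>i\<in>Items D. \<forall>l\<in>Points D. z (VRho i l) \<ge> 0 \<and> z (VPi l) \<ge> 0)}"


subsection \<open>Mixed integer linear programs\<close>

datatype sense = Leq | Geq | Eql

fun sat :: "sense \<Rightarrow> real \<Rightarrow> real \<Rightarrow> bool" where
  "sat Leq a b \<longleftrightarrow> a \<le> b"
| "sat Geq a b \<longleftrightarrow> a \<ge> b"
| "sat Eql a b \<longleftrightarrow> a = b"

record ('v, 'r) milp =
  milp_vars :: "'v set"
  milp_ints :: "'v set"
  milp_cost :: "'v \<Rightarrow> real"
  milp_rows :: "'r set"
  milp_coef :: "'r \<Rightarrow> 'v \<Rightarrow> real"
  milp_sense :: "'r \<Rightarrow> sense"
  milp_rhs :: "'r \<Rightarrow> real"

definition is_milp :: "('v, 'r) milp \<Rightarrow> bool" where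
  "is_milp M \<longleftrightarrow> finite (milp_vars M) \<and> milp_ints M \<subseteq> milp_vars M \<and> finite (milp_rows M)"

definition milp_feasible :: "('v, 'r) milp \<Rightarrow> ('v \<Rightarrow> real) set" where
  "milp_feasible M = {z \<in> milp_vars M \<rightarrow>\<^sub>E UNIV. (\<forall>j\<in>milp_ints M. z j \<in> \<int>) \<and>
     (\<forall>r\<in>milp_rows M.
        sat (milp_sense M r) (\<Sum>j\<in>milp_vars M. milp_coef M r j * z j) (milp_rhs M r))}"

definition milp_obj :: "('v, 'r) milp \<Rightarrow> ('v \<Rightarrow> real) \<Rightarrow> real" where
  "milp_obj M z = (\<Sum>j\<in>milp_vars M. milp_cost M j * z j)"

datatype row = Epi nat | Cover nat nat | Card | XLower nat | XUpper nat | RhoSign nat nat | PiSign nat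

definition slope :: "real \<Rightarrow> real \<Rightarrow> real" where
  "slope a b = pos (a + b) - pos a"

(* The constraints of prog_feasible D hinge_lin with the variables collected on the left-hand side;
   x i in {0,1} becomes integrality together with the two rows 0 <= x i and x i <= 1. *)
fun rrec_coef :: "rrs \<Rightarrow> row \<Rightarrow> prog_var \<Rightarrow> real" where
  "rrec_coef D (Epi l) v = (case v of
       VLambda \<Rightarrow> 1
     | VX i \<Rightarrow> slope (alpha D l - lo D i) (beta D l) - first_cost D i
     | VPi m \<Rightarrow> if m = l then - real (budget D) else 0
     | VRho i m \<Rightarrow> if m = l then - 1 else 0)"
| "rrec_coef D (Cover i l) v =
     (if v = VPi l \<or> v = VRho i l then 1
      else if v = VX i then slope (alpha D l - lo D i - dev D i) (beta D l)
                           - slope (alpha D l - lo D i) (beta D l)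
      else 0)"
| "rrec_coef D Card v = (case v of VX i \<Rightarrow> 1 | _ \<Rightarrow> 0)"
| "rrec_coef D (XLower i) v = (if v = VX i then 1 else 0)"
| "rrec_coef D (XUpper i) v = (if v = VX i then 1 else 0)"
| "rrec_coef D (RhoSign i l) v = (if v = VRho i l then 1 else 0)"
| "rrec_coef D (PiSign l) v = (if v = VPi l then 1 else 0)"

fun rrec_sense :: "row \<Rightarrow> sense" where
  "rrec_sense Card = Eql"
| "rrec_sense (XUpper i) = Leq"
| "rrec_sense _ = Geq"

fun rrec_rhs :: "rrs \<Rightarrow> row \<Rightarrow> real" where
  "rrec_rhs D (Epi l) = real (selsize D) * alpha D l
     + (real (selsize D) - real (recov D)) * beta D l
     - (\<Sum>i\<in>Items D. pos (alpha D l - lo D i))"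
| "rrec_rhs D (Cover i l) = pos (alpha D l - lo D i) - pos (alpha D l - lo D i - dev D i)"
| "rrec_rhs D Card = real (selsize D)"
| "rrec_rhs D (XUpper i) = 1"
| "rrec_rhs D _ = 0"

definition rrec_milp :: "rrs \<Rightarrow> (prog_var, row) milp" where
  "rrec_milp D = \<lparr>
     milp_vars = prog_vars D,
     milp_ints = VX ` Items D,
     milp_cost = (\<lambda>v. if v = VLambda then 1 else 0),
     milp_rows = Epi ` Points D \<union> {Cover i l | i l. i \<in> Items D \<and> l \<in> Points D} \<union> {Card} \<union>
       XLower ` Items D \<union> XUpper ` Items D \<union>
       {RhoSign i l | i l. i \<in> Items D \<and> l \<in> Points D} \<union> PiSign ` Points D,
     milp_coef = rrec_coef D,
     milp_sense = rrec_sense,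
     milp_rhs = rrec_rhs D\<rparr>"

(* n tends to infinity, uniformly in all other data of the instance. *)
definition large_instances :: "rrs filter" where
  "large_instances = (items going_to at_top within {D. valid D})"

end

theory Submission
  imports Defs
begin

text \<open>For a fixed first-stage solution and a fixed scenario, the linear programming dual of the
  recovery problem has the multipliers \<open>\<alpha>\<close> (cardinality) and \<open>\<beta> \<ge> 0\<close> (recovery). By complementary
  slackness an optimal pair can be read off order statistics of the scenario costs: either
  \<open>\<beta> = 0\<close> and \<open>\<alpha>\<close> is the \<open>p\<close>-th smallest cost, or \<open>\<alpha> + \<beta>\<close> is the \<open>(p - k)\<close>-th smallest cost
  inside the first-stage solution and \<open>\<alpha>\<close> is the \<open>k\<close>-th smallest cost outside it. As at most
  \<open>\<Gamma>\<close> costs deviate from their lower bounds, these order statistics lie in the three candidate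
  sets, whatever the scenario, so the maximum over scenarios and dual solutions is a
  maximum over the breakpoints. For a fixed breakpoint the adversary selects the \<open>\<Gamma>\<close> largest
  gains, and LP duality turns this selection into the variables \<open>\<pi>\<close> and \<open>\<rho>\<close>.\<close>

section \<open>Order statistics\<close>

text \<open>Greedy induction on \<open>m\<close>: adjoin a cheapest remaining element.\<close>

lemma ex_smallest_subset:
  fixes c :: "'a \<Rightarrow> 'b::linorder"
  assumes "finite S" "m \<le> card S"
  shows "\<exists>T\<subseteq>S. card T = m \<and> (\<forall>i\<in>T. \<forall>j\<in>S - T. c i \<le> c j)"
  using assms(2)
proof (induction m)
  case 0
  show ?case by (intro exI[of _ "{}"]) auto
next
  case (Suc m)
  then obtain T where T: "T \<subseteq> S" "card T = m" "\<forall>i\<in>T. \<forall>j\<in>S - T. c i \<le> c j" by auto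
  have finT: "finite T" using T(1) assms(1) finite_subset by blast
  have "S \<noteq> T" using T(2) Suc.prems by auto
  then have ne: "c ` (S - T) \<noteq> {}" using T(1) by blast
  have fin: "finite (c ` (S - T))" using assms(1) by simp
  obtain a where "a \<in> S - T" "c a = Min (c ` (S - T))" using Min_in[OF fin ne] by auto
  then have a: "a \<in> S - T" "\<forall>j\<in>S - T. c a \<le> c j" using fin by simp_all
  show ?case
    using T a finT by (intro exI[of _ "insert a T"]) auto
qed

text \<open>A costliest element \<open>j\<close> of a cheapest \<open>m\<close>-subset realises the
  \<open>m\<close>-th order statistic; \<open>1 \<le> m\<close> makes this maximum exist.\<close>

lemma ex_smallest_subset_threshold:
  fixes c :: "'a \<Rightarrow> 'b::linorder"
  assumes "finite S" "1 \<le> m" "m \<le> card S"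
  obtains T j where "T \<subseteq> S" "card T = m" "j \<in> T" "\<forall>i\<in>T. c i \<le> c j" "\<forall>i\<in>S - T. c j \<le> c i"
proof -
  obtain T where T: "T \<subseteq> S" "card T = m" "\<forall>i\<in>T. \<forall>j\<in>S - T. c i \<le> c j"
    using ex_smallest_subset[OF assms(1,3)] by blast
  have fin: "finite (c ` T)" "c ` T \<noteq> {}"
    using T assms finite_subset[OF T(1) assms(1)] by auto
  obtain j where "j \<in> T" "c j = Max (c ` T)"
    using Max_in[OF fin] by auto
  with T fin show ?thesis by (intro that[of T j]) auto
qed

text \<open>Ties with the threshold may lie outside \<open>T\<close>, so only the strict level set
  is controlled; removing \<open>j\<close> supplies the strict inequality in later counts.\<close>

lemma below_threshold_subset:
  fixes c :: "'a \<Rightarrow> 'b::linorder"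
  assumes "\<forall>i\<in>S - T. c j \<le> c i"
  shows "{i \<in> S. c i < c j} \<subseteq> T - {j}"
  using assms by (auto simp: not_le[symmetric])

text \<open>If \<open>f (\<pi> q)\<close> exceeded \<open>u\<close>, monotonicity would confine all
  elements of value at most \<open>u\<close> to the first \<open>q - 1\<close> positions.\<close>

lemma sorted_le_of_card:
  fixes f :: "nat \<Rightarrow> real"
  assumes "\<pi> permutes {1..n}" "mono_on {1..n} (\<lambda>j. f (\<pi> j))"
    and q: "q \<in> {1..n}" "q \<le> card {i \<in> {1..n}. f i \<le> u}"
  shows "f (\<pi> q) \<le> u"
proof (rule ccontr)
  assume "\<not> f (\<pi> q) \<le> u"
  have "{i \<in> {1..n}. f i \<le> u} \<subseteq> \<pi> ` {1..<q}"
  proof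
    fix i assume i: "i \<in> {i \<in> {1..n}. f i \<le> u}"
    then obtain j where j: "j \<in> {1..n}" "i = \<pi> j"
      using permutes_image[OF assms(1)] by blast
    have "j < q"
    proof (rule ccontr)
      assume "\<not> j < q"
      then have "f (\<pi> q) \<le> f (\<pi> j)"
        using assms(2) q(1) j(1) by (auto simp: mono_on_def)
      with i j \<open>\<not> f (\<pi> q) \<le> u\<close> show False by auto
    qed
    then show "i \<in> \<pi> ` {1..<q}" using j by auto
  qed
  then have "card {i \<in> {1..n}. f i \<le> u} \<le> card {1..<q}"
    by (meson card_image_le card_mono finite_atLeastLessThan finite_imageI order.trans)
  then show False using q by auto
qed

text \<open>If \<open>f (\<pi> r)\<close> were below \<open>u\<close>, the \<open>r\<close> distinct
  elements at positions 1 to \<open>r\<close> would all lie strictly below \<open>u\<close>.\<close>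

lemma le_sorted_of_card:
  fixes f :: "nat \<Rightarrow> real"
  assumes "\<pi> permutes {1..n}" "mono_on {1..n} (\<lambda>j. f (\<pi> j))"
    and r: "r \<in> {1..n}" "card {i \<in> {1..n}. f i < u} < r"
  shows "u \<le> f (\<pi> r)"
proof (rule ccontr)
  assume neg: "\<not> u \<le> f (\<pi> r)"
  have "\<pi> ` {1..r} \<subseteq> {i \<in> {1..n}. f i < u}"
  proof
    fix i assume "i \<in> \<pi> ` {1..r}"
    then obtain j where j: "j \<in> {1..r}" "i = \<pi> j" by blast
    have "f (\<pi> j) \<le> f (\<pi> r)"
      using assms(2) r(1) j(1) by (auto simp: mono_on_def)
    moreover have "\<pi> j \<in> {1..n}"
      using j r(1) permutes_in_image[OF assms(1), of j] by auto
    ultimately show "i \<in> {i \<in> {1..n}. f i < u}" using neg j by auto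
  qed
  then have "card (\<pi> ` {1..r}) \<le> card {i \<in> {1..n}. f i < u}"
    by (intro card_mono) auto
  moreover have "card (\<pi> ` {1..r}) = r"
    using permutes_inj[OF assms(1)] by (simp add: card_image inj_on_subset)
  ultimately show False using r by simp
qed


section \<open>Scenarios and the dual of the recovery problem\<close>

text \<open>Indexing scenarios by the set of raised items turns the adversary's choice into a subset
  selection.\<close>

definition scen :: "rrs \<Rightarrow> nat set \<Rightarrow> nat \<Rightarrow> real" where
  "scen D Q = (\<lambda>i\<in>Items D. if i \<in> Q then hi D i else lo D i)"

text \<open>The dual objective of the relaxed recovery problem after eliminating the multipliers of
  the bounds \<open>y i \<le> 1\<close>: for fixed \<open>a\<close> and \<open>b\<close> their
  optimal values are the positive parts.\<close>

definition dual_val :: "rrs \<Rightarrow> (nat \<Rightarrow> real) \<Rightarrow> (nat \<Rightarrow> real) \<Rightarrow> real \<Rightarrow> real \<Rightarrow> real" where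
  "dual_val D x c a b = real (selsize D) * a + (real (selsize D) - real (recov D)) * b
     - (\<Sum>i\<in>Items D. pos (a + b * x i - c i))"

lemma Ud_eq: "Ud D = scen D ` {Q. Q \<subseteq> Items D \<and> card Q \<le> budget D}"
proof (intro equalityI subsetI)
  fix c assume "c \<in> Ud D"
  then obtain \<delta> where c: "c = (\<lambda>i\<in>Items D. lo D i + \<delta> i)"
    and d: "\<forall>i\<in>Items D. \<delta> i \<in> {0, dev D i}" "card {i \<in> Items D. \<delta> i \<noteq> 0} \<le> budget D"
    unfolding Ud_def by blast
  have "c = scen D {i \<in> Items D. \<delta> i \<noteq> 0}"
    unfolding c scen_def using d(1) by (intro restrict_ext) (auto simp: dev_def)
  then show "c \<in> scen D ` {Q. Q \<subseteq> Items D \<and> card Q \<le> budget D}" using d(2) by blast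
next
  fix c assume "c \<in> scen D ` {Q. Q \<subseteq> Items D \<and> card Q \<le> budget D}"
  then obtain Q where Q: "c = scen D Q" "Q \<subseteq> Items D" "card Q \<le> budget D" by blast
  define \<delta> where "\<delta> i = (if i \<in> Q then dev D i else 0)" for i
  \<comment> \<open>Items of \<open>Q\<close> without deviation drop out of the support of
    \<open>\<delta>\<close>, so its size is at most \<open>card Q\<close>.\<close>
  have "card {i \<in> Items D. \<delta> i \<noteq> 0} \<le> card Q"
    using Q finite_subset by (intro card_mono) (auto simp: \<delta>_def split: if_splits)
  moreover have "c = (\<lambda>i\<in>Items D. lo D i + \<delta> i)"
    unfolding Q(1) scen_def by (intro restrict_ext) (auto simp: \<delta>_def dev_def)
  moreover have "\<forall>i\<in>Items D. \<delta> i \<in> {0, dev D i}" by (auto simp: \<delta>_def)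
  ultimately show "c \<in> Ud D" unfolding Ud_def using Q(3) by fastforce
qed

lemma finite_Ud: "finite (Ud D)"
proof -
  have "{Q. Q \<subseteq> Items D \<and> card Q \<le> budget D} \<subseteq> Pow (Items D)" by blast
  then show ?thesis unfolding Ud_eq by (meson finite_Pow_iff finite_atLeastAtMost finite_imageI finite_subset)
qed

lemma Ud_nonempty: "Ud D \<noteq> {}"
proof -
  have "scen D {} \<in> Ud D" unfolding Ud_eq by (rule imageI) simp
  then show ?thesis by blast
qed

lemma finite_Phi: "finite (Phi D)"
  unfolding Phi_def
  by (rule finite_subset[of _ "Items D \<rightarrow>\<^sub>E {0, 1}"]) (blast, simp add: finite_PiE)

lemma finite_Phi_recov: "finite (Phi_recov D x)"
  unfolding Phi_recov_def
  by (rule finite_subset[of _ "Items D \<rightarrow>\<^sub>E {0, 1}"]) (blast, simp add: finite_PiE)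

text \<open>Turns sums of a binary vector into cardinalities, so that the order-statistic argument
  can work with the support of \<open>x\<close>.\<close>

lemma Phi_subset_sum:
  assumes "x \<in> Phi D" "T \<subseteq> Items D"
  shows "(\<Sum>i\<in>T. x i) = real (card (T \<inter> {i \<in> Items D. x i = 1}))"
proof -
  have fin: "finite T" using assms(2) finite_subset by blast
  have "x i = (if i \<in> {i \<in> Items D. x i = 1} then 1 else 0)" if "i \<in> T" for i
  proof -
    have "i \<in> Items D" using assms(2) that by blast
    then show ?thesis using assms(1) by (auto simp: Phi_def PiE_def Pi_def)
  qed
  then have "(\<Sum>i\<in>T. x i) = (\<Sum>i\<in>T. if i \<in> {i \<in> Items D. x i = 1} then 1 else 0)"
    by (intro sum.cong) auto
  also have "\<dots> = (\<Sum>i\<in>T \<inter> {i \<in> Items D. x i = 1}. 1)"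
    using fin by (subst sum.inter_restrict) auto
  finally show ?thesis by simp
qed

lemma Phi_recov_nonempty:
  assumes "x \<in> Phi D"
  shows "Phi_recov D x \<noteq> {}"
proof -
  have "(\<Sum>i\<in>Items D. x i * x i) = (\<Sum>i\<in>Items D. x i)"
    using assms by (intro sum.cong) (auto simp: Phi_def PiE_def Pi_def)
  then have "x \<in> Phi_recov D x" using assms by (auto simp: Phi_def Phi_recov_def)
  then show ?thesis by blast
qed

lemma Phi_nonempty:
  assumes "valid D"
  shows "Phi D \<noteq> {}"
proof -
  define x :: "nat \<Rightarrow> real" where "x = (\<lambda>i\<in>Items D. if i \<in> {1..selsize D} then 1 else 0)"
  have "(\<Sum>i\<in>Items D. x i) = (\<Sum>i\<in>Items D. if i \<in> {1..selsize D} then 1 else 0)"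
    by (intro sum.cong) (auto simp: x_def)
  also have "\<dots> = (\<Sum>i\<in>Items D \<inter> {1..selsize D}. 1)" by (subst sum.inter_restrict) auto
  also have "Items D \<inter> {1..selsize D} = {1..selsize D}" using assms by (auto simp: valid_def)
  finally have "x \<in> Phi D" unfolding Phi_def by (auto simp: x_def)
  then show ?thesis by blast
qed

text \<open>Weak duality: for binary \<open>y i\<close> each term is at most its positive part.
  After summation the cardinality equation evaluates the \<open>a\<close>-term, and
  \<open>b \<ge> 0\<close> preserves the recovery inequality.\<close>

lemma dual_val_le:
  assumes "y \<in> Phi_recov D x" "b \<ge> 0"
  shows "dual_val D x c a b \<le> (\<Sum>i\<in>Items D. c i * y i)"
proof -
  have "(a + b * x i - c i) * y i \<le> pos (a + b * x i - c i)" if "i \<in> Items D" for i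
    using assms(1) that by (auto simp: Phi_recov_def PiE_def Pi_def pos_def)
  then have "(\<Sum>i\<in>Items D. (a + b * x i - c i) * y i) \<le> (\<Sum>i\<in>Items D. pos (a + b * x i - c i))"
    by (rule sum_mono)
  also have "(\<Sum>i\<in>Items D. (a + b * x i - c i) * y i)
      = a * (\<Sum>i\<in>Items D. y i) + b * (\<Sum>i\<in>Items D. x i * y i) - (\<Sum>i\<in>Items D. c i * y i)"
    by (simp add: algebra_simps sum.distrib sum_subtractf sum_distrib_left)
  finally have *: "a * real (selsize D) + b * (\<Sum>i\<in>Items D. x i * y i)
      \<le> (\<Sum>i\<in>Items D. c i * y i) + (\<Sum>i\<in>Items D. pos (a + b * x i - c i))"
    using assms(1) by (simp add: Phi_recov_def)
  have "b * (real (selsize D) - real (recov D)) \<le> b * (\<Sum>i\<in>Items D. x i * y i)"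
    using assms by (intro mult_left_mono) (auto simp: Phi_recov_def)
  with * show ?thesis by (simp add: dual_val_def algebra_simps)
qed

text \<open>The indicator of \<open>T\<close> makes both estimates of weak duality equalities:
  \<open>T\<close> takes only items with nonnegative \<open>a + b * x i - c i\<close> and omits only
  items where it is nonpositive, and \<open>b\<close> is zero or multiplies a tight
  constraint.\<close>

lemma complementary_slackness:
  assumes x: "x \<in> Phi D" and T: "T \<subseteq> Items D" "card T = selsize D"
    and le: "\<And>i. i \<in> T \<Longrightarrow> c i \<le> a + b * x i"
    and ge: "\<And>i. i \<in> Items D - T \<Longrightarrow> a + b * x i \<le> c i"
    and rec: "real (selsize D) - real (recov D) \<le> (\<Sum>i\<in>T. x i)"
    and slack: "b = 0 \<or> (\<Sum>i\<in>T. x i) = real (selsize D) - real (recov D)"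
  shows "\<exists>y\<in>Phi_recov D x. (\<Sum>i\<in>Items D. c i * y i) = dual_val D x c a b"
proof
  define y :: "nat \<Rightarrow> real" where "y = (\<lambda>i\<in>Items D. if i \<in> T then 1 else 0)"
  have restr: "(\<Sum>i\<in>Items D. f i * y i) = (\<Sum>i\<in>T. f i)" for f :: "nat \<Rightarrow> real"
  proof -
    have "(\<Sum>i\<in>Items D. f i * y i) = (\<Sum>i\<in>Items D. if i \<in> T then f i else 0)"
      by (intro sum.cong) (auto simp: y_def)
    also have "\<dots> = (\<Sum>i\<in>Items D \<inter> T. f i)" by (subst sum.inter_restrict) auto
    also have "Items D \<inter> T = T" using T by auto
    finally show ?thesis .
  qed
  have fin: "finite T" using T(1) finite_subset by blast
  show "y \<in> Phi_recov D x"
    using restr[of "\<lambda>_. 1"] restr[of x] T(2) rec by (auto simp: Phi_recov_def y_def)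
  have "(\<Sum>i\<in>Items D. pos (a + b * x i - c i)) = (\<Sum>i\<in>Items D. (a + b * x i - c i) * y i)"
    using le ge by (intro sum.cong refl) (force simp: y_def pos_def)
  also have "\<dots> = a * real (selsize D) + b * (\<Sum>i\<in>T. x i) - (\<Sum>i\<in>T. c i)"
    unfolding restr using T(2) fin by (simp add: sum.distrib sum_subtractf sum_distrib_left)
  also have "b * (\<Sum>i\<in>T. x i) = b * (real (selsize D) - real (recov D))" using slack by auto
  finally show "(\<Sum>i\<in>Items D. c i * y i) = dual_val D x c a b"
    unfolding restr dual_val_def by (simp add: algebra_simps)
qed


section \<open>Optimal dual solutions among the breakpoints\<close>

text \<open>The counts locate \<open>u\<close> in sorted order up to ties. An unraised
  \<open>j\<close> makes \<open>u\<close> a lower bound, and passing from scenario costs to lower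
  bounds shifts the strict count by at most the budget. A raised \<open>j\<close> makes
  \<open>u\<close> an upper bound, and passing to upper bounds only decreases the strict
  count.\<close>

lemma scen_value_mem:
  assumes v: "valid D" and Q: "Q \<subseteq> Items D" "card Q \<le> budget D"
    and j: "j \<in> Items D" and u: "u = scen D Q j"
    and q: "q \<le> card {i \<in> Items D. scen D Q i \<le> u}"
    and r: "card {i \<in> Items D. scen D Q i < u} < r"
    and qr: "q \<le> r + budget D"
  shows "u \<in> lo_sorted D ` {q..r + budget D} \<union> hi_sorted D ` {1..r}"
proof -
  have bnd: "lo D i \<le> scen D Q i" "scen D Q i \<le> hi D i" if "i \<in> Items D" for i
    using v that by (auto simp: scen_def valid_def)
  have finQ: "finite Q" using Q(1) finite_subset by blast
  have permlo: "perm_lo D permutes Items D" and ml: "mono_on (Items D) (\<lambda>j. lo D (perm_lo D j))"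
    and ph: "perm_hi D permutes Items D" and mh: "mono_on (Items D) (\<lambda>j. hi D (perm_hi D j))"
    using v by (auto simp: valid_def)
  show ?thesis
  proof (cases "j \<in> Q")
    case False
    then have uj: "u = lo D j" using u j by (simp add: scen_def)
    obtain s where s: "s \<in> Items D" "perm_lo D s = j"
      using permutes_image[OF permlo] j by (metis imageE)
    then have us: "u = lo_sorted D s" using uj by (simp add: lo_sorted_def)
    have "{i \<in> Items D. scen D Q i \<le> u} \<subseteq> {i \<in> Items D. lo D i \<le> u}"
      using bnd order.trans by blast
    then have "card {i \<in> Items D. scen D Q i \<le> u} \<le> card {i \<in> Items D. lo D i \<le> u}"
      by (intro card_mono) auto
    with q have c1: "q \<le> card {i \<in> Items D. lo D i \<le> u}" by linarith
    \<comment> \<open>Only a raised item can have its lower bound below \<open>u\<close> and its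
      scenario cost not below \<open>u\<close>.\<close>
    have "{i \<in> Items D. lo D i < u} \<subseteq> {i \<in> Items D. scen D Q i < u} \<union> Q"
      by (auto simp: scen_def)
    then have "card {i \<in> Items D. lo D i < u} \<le> card ({i \<in> Items D. scen D Q i < u} \<union> Q)"
      using finQ by (intro card_mono) auto
    also have "\<dots> \<le> card {i \<in> Items D. scen D Q i < u} + card Q" by (rule card_Un_le)
    finally have c2: "card {i \<in> Items D. lo D i < u} < r + budget D" using r Q(2) by linarith
    \<comment> \<open>The position \<open>s\<close> depends on how the permutation breaks ties and
      may miss the window; the nearest endpoint then carries the same value.\<close>
    consider "s < q" | "q \<le> s" "s \<le> r + budget D" | "r + budget D < s" by linarith
    then show ?thesis
    proof cases
      case 1
      have "card {i \<in> Items D. lo D i \<le> u} \<le> card (Items D)" by (intro card_mono) auto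
      then have qI: "q \<in> Items D" using c1 1 s by auto
      have "lo D (perm_lo D q) \<le> u" by (rule sorted_le_of_card[OF permlo ml qI c1])
      moreover have "u \<le> lo D (perm_lo D q)"
        using ml s qI 1 uj by (auto simp: mono_on_def)
      ultimately have "u = lo_sorted D q" using qI by (simp add: lo_sorted_def)
      then show ?thesis using qr by auto
    next
      case 2
      then show ?thesis using us by auto
    next
      case 3
      then have rI: "r + budget D \<in> Items D" using r s by auto
      have "u \<le> lo D (perm_lo D (r + budget D))" by (rule le_sorted_of_card[OF permlo ml rI c2])
      moreover have "lo D (perm_lo D (r + budget D)) \<le> u"
        using ml s rI 3 uj by (auto simp: mono_on_def)
      ultimately have "u = lo_sorted D (r + budget D)" using rI by (simp add: lo_sorted_def)
      then show ?thesis using qr by auto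
    qed
  next
    case True
    then have uj: "u = hi D j" using u j by (simp add: scen_def)
    obtain s where s: "s \<in> Items D" "perm_hi D s = j"
      using permutes_image[OF ph] j by (metis imageE)
    then have us: "u = hi_sorted D s" using uj by (simp add: hi_sorted_def)
    have "{i \<in> Items D. hi D i < u} \<subseteq> {i \<in> Items D. scen D Q i < u}"
      using bnd le_less_trans by blast
    then have "card {i \<in> Items D. hi D i < u} \<le> card {i \<in> Items D. scen D Q i < u}"
      by (intro card_mono) auto
    then have c2: "card {i \<in> Items D. hi D i < u} < r" using r by linarith
    show ?thesis
    proof (cases "s \<le> r")
      case True
      then show ?thesis using us s by auto
    next
      case False
      then have rI: "r \<in> Items D" using r s by auto
      have "u \<le> hi D (perm_hi D r)" by (rule le_sorted_of_card[OF ph mh rI c2])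
      moreover have "hi D (perm_hi D r) \<le> u"
        using mh s rI False uj by (auto simp: mono_on_def)
      ultimately have "u = hi_sorted D r" using rI by (simp add: hi_sorted_def)
      then show ?thesis using rI by auto
    qed
  qed
qed

text \<open>For \<open>q = 0\<close> the index is clamped to 1, so the count must be positive; the
  item \<open>j\<close> ensures this.\<close>

lemma lo_sorted_le_of_card:
  assumes v: "valid D"
    and q: "q \<le> card {i \<in> Items D. lo D i \<le> u}" and ne: "j \<in> Items D" "lo D j \<le> u"
  shows "lo_sorted D q \<le> u"
proof -
  have permlo: "perm_lo D permutes Items D"
    and ml: "mono_on (Items D) (\<lambda>j. lo D (perm_lo D j))"
    using v by (auto simp: valid_def)
  have "card {i \<in> Items D. lo D i \<le> u} > 0" using ne by (auto simp: card_gt_0_iff)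
  then have q': "max 1 q \<le> card {i \<in> Items D. lo D i \<le> u}" using q by simp
  have "card {i \<in> Items D. lo D i \<le> u} \<le> card (Items D)" by (intro card_mono) auto
  then have qI: "max 1 q \<in> Items D" using q' by auto
  have "lo D (perm_lo D (max 1 q)) \<le> u"
    by (rule sorted_le_of_card[OF permlo ml qI q'])
  moreover have "max 1 (min (items D) q) = max 1 q" using qI by auto
  ultimately show ?thesis by (simp add: lo_sorted_def)
qed

text \<open>If some \<open>p\<close> cheapest items respect the recovery constraint, it is slack and
  \<open>b = 0\<close> works. Otherwise the \<open>p - k\<close> cheapest items of the support and
  the \<open>k\<close> cheapest items outside it are combined, with separate thresholds.\<close>

lemma breakpoint_attains:
  assumes v: "valid D" and x: "x \<in> Phi D" and Q: "Q \<subseteq> Items D" "card Q \<le> budget D"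
  defines "c \<equiv> scen D Q"
  shows "\<exists>a b. (a, b) \<in> breakpoints D \<and>
    (\<exists>y\<in>Phi_recov D x. (\<Sum>i\<in>Items D. c i * y i) = dual_val D x c a b)"
proof -
  define X where "X = {i \<in> Items D. x i = 1}"
  define p k n where "p = selsize D" and "k = recov D" and "n = items D"
  note sums = Phi_subset_sum[OF x, folded X_def]
  have pn: "1 \<le> p" "p \<le> n" "k \<le> p" using v by (auto simp: valid_def p_def k_def n_def)
  have XI: "X \<subseteq> Items D" by (auto simp: X_def)
  have finX: "finite X" using XI finite_subset by blast
  have x01: "x i = (if i \<in> X then 1 else 0)" if "i \<in> Items D" for i
    using x that by (auto simp: X_def Phi_def PiE_def Pi_def)
  have "real (card X) = real p"
    using sums[of "Items D"] x XI by (simp add: Phi_def p_def Int_absorb1)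
  then have cX: "card X = p" by simp
  have finI: "finite (Items D)" and pI: "p \<le> card (Items D)" using pn by (simp_all add: n_def)
  have cN: "card (Items D - X) = n - p"
    using XI cX finX by (simp add: card_Diff_subset n_def)
  have lo_c: "lo D i \<le> c i" if "i \<in> Items D" for i
    using v that by (auto simp: c_def scen_def valid_def)

  \<comment> \<open>Kept general in \<open>T\<close> because it serves twice: for the globally
    cheapest items and for a combined set whose two thresholds coincide.\<close>
  have slack_case: ?thesis
    if T: "T \<subseteq> Items D" "card T = p" "j \<in> T" "\<forall>i\<in>T. c i \<le> c j" "\<forall>i\<in>Items D - T. c j \<le> c i"
      and TX: "p - k \<le> card (T \<inter> X)" for T j
  proof -
    have jI: "j \<in> Items D" using T by blast
    have finT: "finite T" using T(1) finite_subset by blast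
    have "T \<subseteq> {i \<in> Items D. c i \<le> c j}" using T by auto
    then have q: "p \<le> card {i \<in> Items D. c i \<le> c j}"
      using card_mono[of "{i \<in> Items D. c i \<le> c j}" T] T(2) by simp
    have "{i \<in> Items D. c i < c j} \<subseteq> T - {j}" by (rule below_threshold_subset[OF T(5)])
    then have "card {i \<in> Items D. c i < c j} \<le> card (T - {j})" using finT by (intro card_mono) auto
    then have r: "card {i \<in> Items D. c i < c j} < p" using T finT pn by simp
    have "c j \<in> C_p D"
      using scen_value_mem[OF v Q jI refl, of p p, folded c_def, OF q r]
      by (simp add: C_p_def p_def)
    \<comment> \<open>A pair \<open>(u, 0)\<close> is a breakpoint only if some
      \<open>v \<in> C_pk D\<close> is at most \<open>u\<close>; the clamped
      \<open>(p - k)\<close>-th smallest lower bound serves as \<open>v\<close>.\<close>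
    moreover have "lo_sorted D (p - k) \<in> C_pk D"
      using pn unfolding C_pk_def p_def k_def n_def by force
    moreover have "lo_sorted D (p - k) \<le> c j"
    proof (rule lo_sorted_le_of_card[OF v _ jI lo_c[OF jI]])
      have "{i \<in> Items D. c i \<le> c j} \<subseteq> {i \<in> Items D. lo D i \<le> c j}"
        using lo_c order.trans by blast
      then have "card {i \<in> Items D. c i \<le> c j} \<le> card {i \<in> Items D. lo D i \<le> c j}"
        by (intro card_mono) auto
      then show "p - k \<le> card {i \<in> Items D. lo D i \<le> c j}" using q by linarith
    qed
    ultimately have "(c j, 0) \<in> breakpoints D" unfolding breakpoints_def by blast
    moreover have "\<exists>y\<in>Phi_recov D x. (\<Sum>i\<in>Items D. c i * y i) = dual_val D x c (c j) 0"
    proof (rule complementary_slackness[OF x T(1) T(2)[unfolded p_def]])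
      have "real (p - k) \<le> real (card (T \<inter> X))" using TX by linarith
      then show "real (selsize D) - real (recov D) \<le> (\<Sum>i\<in>T. x i)"
        using sums[OF T(1)] pn by (simp add: p_def k_def of_nat_diff)
    qed (use T in simp_all)
    ultimately show ?thesis by blast
  qed

  obtain T j where T: "T \<subseteq> Items D" "card T = p" "j \<in> T" "\<forall>i\<in>T. c i \<le> c j"
      "\<forall>i\<in>Items D - T. c j \<le> c i"
    by (rule ex_smallest_subset_threshold[OF finI pn(1) pI])
  have finT: "finite T" using T(1) finite_subset by blast
  show ?thesis
  proof (cases "p - k \<le> card (T \<inter> X)")
    case True
    then show ?thesis using slack_case[OF T] by blast
  next
    case False
    \<comment> \<open>Too few items of \<open>T\<close> in \<open>X\<close> means more than
      \<open>k\<close> outside, so the complement of \<open>X\<close> is large enough for the choice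
      of \<open>B\<close>.\<close>
    have "card T = card (T \<inter> X) + card (T - X)"
      by (rule card_Int_Diff[OF finT])
    then have TN: "k < card (T - X)" using T(2) False pn by linarith
    have "card (T - X) \<le> card (Items D - X)" using T(1) by (intro card_mono) auto
    then have kN: "k < n - p" using TN cN by linarith
    have pk: "1 \<le> p - k" "p - k \<le> card X" using False cX by simp_all
    obtain A a where A: "A \<subseteq> X" "card A = p - k" "a \<in> A" "\<forall>i\<in>A. c i \<le> c a"
        "\<forall>i\<in>X - A. c a \<le> c i"
      by (rule ex_smallest_subset_threshold[OF finX pk])
    have finA: "finite A" using A(1) finX finite_subset by blast
    have aI: "a \<in> Items D" using A XI by blast
    have "\<exists>B w. B \<subseteq> Items D - X \<and> card B = k \<and> (\<forall>i\<in>B. c i \<le> w) \<and>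
       (\<forall>i\<in>Items D - X - B. w \<le> c i) \<and> w \<in> C_k D"
    proof (cases "k = 0")
      case True
      \<comment> \<open>There is no \<open>0\<close>-th smallest cost; index \<open>0\<close> is clamped to \<open>1\<close>, which gives the least lower bound.\<close>
      have "lo_sorted D k \<le> c i" if "i \<in> Items D" for i
        using lo_sorted_le_of_card[OF v _ that lo_c[OF that], of k] True by simp
      moreover have "lo_sorted D k \<in> C_k D" unfolding C_k_def k_def by force
      ultimately show ?thesis
        using True by (intro exI[of _ "{}"] exI[of _ "lo_sorted D k"]) auto
    next
      case False
      have k: "finite (Items D - X)" "1 \<le> k" "k \<le> card (Items D - X)"
        using False cN kN by simp_all
      obtain B b where B: "B \<subseteq> Items D - X" "card B = k" "b \<in> B" "\<forall>i\<in>B. c i \<le> c b"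
          "\<forall>i\<in>Items D - X - B. c b \<le> c i"
        by (rule ex_smallest_subset_threshold[OF k])
      have finB: "finite B" using B(1) finite_subset by blast
      have bI: "b \<in> Items D" using B by blast
      have "B \<subseteq> {i \<in> Items D. c i \<le> c b}" using B by auto
      then have q: "k \<le> card {i \<in> Items D. c i \<le> c b}"
        using card_mono[of "{i \<in> Items D. c i \<le> c b}" B] B(2) by simp
      \<comment> \<open>All \<open>p\<close> items of \<open>X\<close> may be cheaper than
        \<open>b\<close>; this is where the upper rank \<open>k + p\<close> in \<open>C_k\<close>
        comes from.\<close>
      have "{i \<in> Items D. c i < c b} \<subseteq> (B - {b}) \<union> X"
        using below_threshold_subset[OF B(5)] by blast
      then have "card {i \<in> Items D. c i < c b} \<le> card ((B - {b}) \<union> X)"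
        using finB finX by (intro card_mono) auto
      also have "\<dots> \<le> card (B - {b}) + card X" by (rule card_Un_le)
      finally have r: "card {i \<in> Items D. c i < c b} < k + p" using B finB cX False by simp
      have "c b \<in> C_k D"
        using scen_value_mem[OF v Q bI refl, of k "k + p", folded c_def, OF q r]
        by (simp add: C_k_def p_def k_def)
      with B show ?thesis by blast
    qed
    then obtain B w where B: "B \<subseteq> Items D - X" "card B = k" "\<forall>i\<in>B. c i \<le> w"
      "\<forall>i\<in>Items D - X - B. w \<le> c i" "w \<in> C_k D" by blast
    have finB: "finite B" using B(1) finite_subset by blast
    have vmem: "c a \<in> C_pk D"
    proof -
      have "A \<subseteq> {i \<in> Items D. c i \<le> c a}" using A XI by auto
      then have q: "p - k \<le> card {i \<in> Items D. c i \<le> c a}"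
        using card_mono[of "{i \<in> Items D. c i \<le> c a}" A] A(2) by simp
      \<comment> \<open>All \<open>n - p\<close> items outside \<open>X\<close> may be cheaper than
        \<open>a\<close>, which gives the rank \<open>(p - k) + (n - p) = n - k\<close> in
        \<open>C_pk\<close>.\<close>
      have "{i \<in> Items D. c i < c a} \<subseteq> (A - {a}) \<union> (Items D - X)"
        using below_threshold_subset[OF A(5)] by blast
      then have "card {i \<in> Items D. c i < c a} \<le> card ((A - {a}) \<union> (Items D - X))"
        using finA by (intro card_mono) auto
      also have "\<dots> \<le> card (A - {a}) + card (Items D - X)" by (rule card_Un_le)
      finally have r: "card {i \<in> Items D. c i < c a} < n - k"
        using A finA cN False pn by simp
      show ?thesis
        using scen_value_mem[OF v Q aI refl, of "p - k" "n - k", folded c_def, OF q r] pn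
        by (simp add: C_pk_def p_def k_def n_def)
    qed
    have ABI: "A \<union> B \<subseteq> Items D" using A(1) B(1) XI by blast
    have "A \<inter> B = {}" using A(1) B(1) by blast
    then have cAB: "card (A \<union> B) = p"
      using card_Un_disjoint[OF finA finB] A(2) B(2) pn by simp
    have ABX: "(A \<union> B) \<inter> X = A" using A(1) B(1) by blast
    \<comment> \<open>To obtain \<open>w \<le> c a\<close>, and hence a nonnegative second
      multiplier, compare through \<open>T\<close>: it misses some \<open>a'\<close> of
      \<open>A\<close> and contains some \<open>b'\<close> outside both \<open>X\<close> and
      \<open>B\<close>.\<close>
    have "\<not> A \<subseteq> T"
    proof
      assume "A \<subseteq> T"
      then have "card A \<le> card (T \<inter> X)" using A(1) finT by (intro card_mono) auto
      then show False using A(2) False by simp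
    qed
    then obtain a' where a': "a' \<in> A" "a' \<notin> T" by blast
    have "\<not> T - X \<subseteq> B" using TN B(2) finB card_mono by (metis linorder_not_less)
    then obtain b' where b': "b' \<in> T" "b' \<notin> X" "b' \<notin> B" by blast
    have "w \<le> c b'" using b' B(4) T(1) by blast
    also have "\<dots> \<le> c j" using T(4) b'(1) by blast
    also have "\<dots> \<le> c a'" using T(5) a' A(1) XI by blast
    also have "\<dots> \<le> c a" using A(4) a'(1) by blast
    finally have "w \<le> c a" .
    show ?thesis
    proof (cases "w = c a")
      case True
      \<comment> \<open>The threshold is the same inside and outside \<open>X\<close>, so \<open>A \<union> B\<close> consists of \<open>p\<close> cheapest items.\<close>
      have "\<forall>i\<in>A \<union> B. c i \<le> c a" using A(4) B(3) unfolding True by blast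
      moreover have "\<forall>i\<in>Items D - (A \<union> B). c a \<le> c i"
        using A(5) B(4) unfolding True by blast
      moreover have "a \<in> A \<union> B" using A(3) by blast
      moreover have "p - k \<le> card ((A \<union> B) \<inter> X)" unfolding ABX A(2) by simp
      ultimately show ?thesis by (intro slack_case[OF ABI cAB, of a])
    next
      case False
      with \<open>w \<le> c a\<close> have "w < c a" by simp
      then have "(w, c a - w) \<in> breakpoints D" unfolding breakpoints_def using vmem B(5) by blast
      \<comment> \<open>The threshold \<open>w + (c a - w) * x i\<close> is \<open>c a\<close> on
        \<open>X\<close> and \<open>w\<close> elsewhere, and \<open>A \<union> B\<close> meets
        \<open>X\<close> in exactly \<open>p - k\<close> items, so the recovery constraint is
        tight.\<close>
      moreover have "\<exists>y\<in>Phi_recov D x. (\<Sum>i\<in>Items D. c i * y i) = dual_val D x c w (c a - w)"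
      proof (rule complementary_slackness[OF x ABI cAB[unfolded p_def]])
        show "c i \<le> w + (c a - w) * x i" if "i \<in> A \<union> B" for i
          using that A(1,4) B(1,3) x01[of i] subsetD[OF ABI that] by (auto simp del: atLeastAtMost_iff)
        show "w + (c a - w) * x i \<le> c i" if "i \<in> Items D - (A \<union> B)" for i
          using that A(5) B(4) x01[of i] by (auto simp del: atLeastAtMost_iff)
        have "(\<Sum>i\<in>A \<union> B. x i) = real (selsize D) - real (recov D)"
          using sums[OF ABI] ABX A(2) pn by (simp add: p_def k_def of_nat_diff)
        then show "real (selsize D) - real (recov D) \<le> (\<Sum>i\<in>A \<union> B. x i)"
          and "c a - w = 0 \<or> (\<Sum>i\<in>A \<union> B. x i) = real (selsize D) - real (recov D)" by auto
      qed
      ultimately show ?thesis by blast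
    qed
  qed
qed


section \<open>The budgeted adversary\<close>

text \<open>Sum the covering inequalities over \<open>Q\<close>, then enlarge \<open>card Q\<close>
  to \<open>\<Gamma>\<close> and \<open>Q\<close> to \<open>I\<close> by nonnegativity.\<close>

lemma budget_dual_weak:
  fixes g \<rho> :: "'a \<Rightarrow> real"
  assumes "finite I" "Q \<subseteq> I" "card Q \<le> \<Gamma>" "\<pi> \<ge> 0" "\<And>i. i \<in> I \<Longrightarrow> \<rho> i \<ge> 0"
    and "\<And>i. i \<in> I \<Longrightarrow> \<pi> + \<rho> i \<ge> g i"
  shows "(\<Sum>i\<in>Q. g i) \<le> real \<Gamma> * \<pi> + (\<Sum>i\<in>I. \<rho> i)"
proof -
  have "(\<Sum>i\<in>Q. g i) \<le> (\<Sum>i\<in>Q. \<pi> + \<rho> i)" using assms by (intro sum_mono) auto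
  also have "\<dots> = real (card Q) * \<pi> + (\<Sum>i\<in>Q. \<rho> i)" by (simp add: sum.distrib)
  also have "\<dots> \<le> real \<Gamma> * \<pi> + (\<Sum>i\<in>I. \<rho> i)"
    using assms by (intro add_mono mult_right_mono sum_mono2) auto
  finally show ?thesis .
qed

text \<open>An optimal \<open>\<pi>\<close> is the \<open>(\<Gamma> + 1)\<close>-th largest gain, or
  0 if the budget covers all of \<open>I\<close>; \<open>\<rho>\<close> is the excess over
  \<open>\<pi>\<close>, and \<open>Q\<close> collects the largest gains.\<close>

lemma budget_dual_attained:
  fixes g :: "'a \<Rightarrow> real"
  assumes "finite I" "\<And>i. i \<in> I \<Longrightarrow> g i \<ge> 0"
  shows "\<exists>Q \<pi> \<rho>. Q \<subseteq> I \<and> card Q \<le> \<Gamma> \<and> \<pi> \<ge> 0 \<and> (\<forall>i\<in>I. \<rho> i \<ge> 0) \<and>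
    (\<forall>i\<in>I. \<pi> + \<rho> i \<ge> g i) \<and> real \<Gamma> * \<pi> + (\<Sum>i\<in>I. \<rho> i) = (\<Sum>i\<in>Q. g i)"
proof (cases "card I \<le> \<Gamma>")
  case True
  then show ?thesis using assms by (intro exI[of _ I] exI[of _ 0] exI[of _ g]) auto
next
  case False
  have \<Gamma>: "1 \<le> card I - \<Gamma>" "card I - \<Gamma> \<le> card I" using False by simp_all
  \<comment> \<open>\<open>T\<close> holds the smallest gains, so its maximum \<open>g j\<close> is
    the largest gain outside the selection \<open>I - T\<close>.\<close>
  obtain T j where T: "T \<subseteq> I" "card T = card I - \<Gamma>" "j \<in> T" "\<forall>i\<in>T. g i \<le> g j"
      "\<forall>i\<in>I - T. g j \<le> g i"
    by (rule ex_smallest_subset_threshold[OF assms(1) \<Gamma>])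
  have finT: "finite T" using T(1) assms(1) finite_subset by blast
  have cQ: "card (I - T) = \<Gamma>" using T finT False by (simp add: card_Diff_subset)
  have "(\<Sum>i\<in>I. max 0 (g i - g j)) = (\<Sum>i\<in>I - T. max 0 (g i - g j)) + (\<Sum>i\<in>T. max 0 (g i - g j))"
    using assms(1) T(1) by (rule sum.subset_diff[rotated])
  also have "(\<Sum>i\<in>T. max 0 (g i - g j)) = 0" using T by (intro sum.neutral) auto
  also have "(\<Sum>i\<in>I - T. max 0 (g i - g j)) = (\<Sum>i\<in>I - T. g i - g j)"
    using T by (intro sum.cong) auto
  finally have "real \<Gamma> * g j + (\<Sum>i\<in>I. max 0 (g i - g j)) = (\<Sum>i\<in>I - T. g i)"
    using cQ by (simp add: sum_subtractf)
  then show ?thesis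
    using T cQ assms
    by (intro exI[of _ "I - T"] exI[of _ "g j"] exI[of _ "\<lambda>i. max 0 (g i - g j)"]) auto
qed

text \<open>The growth of the dual value when item \<open>i\<close> is raised from its lower to its
  upper bound.\<close>

definition gain :: "rrs \<Rightarrow> (nat \<Rightarrow> real) \<Rightarrow> real \<Rightarrow> real \<Rightarrow> nat \<Rightarrow> real" where
  "gain D x a b i = hinge (a - lo D i) b (x i) - hinge (a - lo D i - dev D i) b (x i)"

lemma gain_nonneg:
  assumes "valid D" "i \<in> Items D"
  shows "gain D x a b i \<ge> 0"
proof -
  have "lo D i \<le> hi D i" using assms by (simp add: valid_def)
  then show ?thesis by (simp add: gain_def hinge_def pos_def dev_def)
qed

text \<open>For fixed multipliers the dual value is separable over items, so the adversary just
  maximises a sum of gains over \<open>Q\<close>.\<close>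

lemma dual_val_scen:
  assumes "Q \<subseteq> Items D"
  shows "dual_val D x (scen D Q) a b = real (selsize D) * a
    + (real (selsize D) - real (recov D)) * b
    - (\<Sum>i\<in>Items D. hinge (a - lo D i) b (x i)) + (\<Sum>i\<in>Q. gain D x a b i)"
proof -
  have "(\<Sum>i\<in>Items D. pos (a + b * x i - scen D Q i))
      = (\<Sum>i\<in>Items D. hinge (a - lo D i) b (x i) - (if i \<in> Q then gain D x a b i else 0))"
    by (intro sum.cong) (auto simp: scen_def gain_def hinge_def dev_def algebra_simps)
  also have "\<dots> = (\<Sum>i\<in>Items D. hinge (a - lo D i) b (x i)) - (\<Sum>i\<in>Items D \<inter> Q. gain D x a b i)"
    by (subst sum.inter_restrict) (auto simp: sum_subtractf)
  also have "Items D \<inter> Q = Q" using assms by blast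
  finally show ?thesis by (simp add: dual_val_def)
qed


section \<open>Equivalence with the program\<close>

lemma breakpoints_snd_nonneg: "(a, b) \<in> breakpoints D \<Longrightarrow> b \<ge> 0"
  by (auto simp: breakpoints_def)

lemma prog_feasible_x_part: "z \<in> prog_feasible D h \<Longrightarrow> x_part D z \<in> Phi D"
  unfolding prog_feasible_def Phi_def x_part_def by (auto intro!: restrict_PiE_iff[THEN iffD2])

text \<open>Take a worst scenario and a breakpoint attaining its recovery value. Weak budget duality
  bounds the gains by \<open>\<pi>\<close> and \<open>\<rho>\<close>, and the epigraph row of that
  breakpoint finishes.\<close>

lemma rrec_obj_le:
  assumes v: "valid D" and z: "z \<in> prog_feasible D hinge"
  shows "rrec_obj D (x_part D z) \<le> z VLambda"
proof -
  define x where "x = x_part D z"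
  have x: "x \<in> Phi D" using prog_feasible_x_part[OF z] x_def by simp
  have xz: "x i = z (VX i)" if "i \<in> Items D" for i using that by (simp add: x_def x_part_def)
  define inner where "inner c = Min ((\<lambda>y. \<Sum>i\<in>Items D. c i * y i) ` Phi_recov D x)" for c
  have "Max (inner ` Ud D) \<in> inner ` Ud D"
    using finite_Ud Ud_nonempty by (intro Max_in) auto
  then obtain Q where Q: "Q \<subseteq> Items D" "card Q \<le> budget D"
    and m: "Max (inner ` Ud D) = inner (scen D Q)" unfolding Ud_eq by auto
  obtain a b y where ab: "(a, b) \<in> breakpoints D" and y: "y \<in> Phi_recov D x"
    and eq: "(\<Sum>i\<in>Items D. scen D Q i * y i) = dual_val D x (scen D Q) a b"
    using breakpoint_attains[OF v x Q] by blast
  have "(a, b) \<in> (\<lambda>l. (alpha D l, beta D l)) ` Points D"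
    using v ab by (auto simp: valid_def bij_betw_def)
  then obtain l where l: "l \<in> Points D" "a = alpha D l" "b = beta D l" by auto
  have "inner (scen D Q) \<le> dual_val D x (scen D Q) a b"
    unfolding inner_def eq[symmetric] using y finite_Phi_recov by (intro Min_le) auto
  \<comment> \<open>The program imposes \<open>\<pi> \<ge> 0\<close> under a quantifier over items;
    validity supplies an item.\<close>
  also have "(\<Sum>i\<in>Q. gain D x a b i) \<le> real (budget D) * z (VPi l) + (\<Sum>i\<in>Items D. z (VRho i l))"
    using z l Q v xz
    by (intro budget_dual_weak) (auto simp: prog_feasible_def gain_def valid_def)
  then have "dual_val D x (scen D Q) a b \<le> real (selsize D) * a
    + (real (selsize D) - real (recov D)) * b
    - (\<Sum>i\<in>Items D. hinge (a - lo D i) b (x i)) + (real (budget D) * z (VPi l) + (\<Sum>i\<in>Items D. z (VRho i l)))"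
    unfolding dual_val_scen[OF Q(1)] by simp
  finally have "(\<Sum>i\<in>Items D. first_cost D i * x i) + inner (scen D Q) \<le> z VLambda"
  proof -
    assume *: "inner (scen D Q) \<le> real (selsize D) * a
    + (real (selsize D) - real (recov D)) * b
    - (\<Sum>i\<in>Items D. hinge (a - lo D i) b (x i)) + (real (budget D) * z (VPi l) + (\<Sum>i\<in>Items D. z (VRho i l)))"
    have "(\<Sum>i\<in>Items D. first_cost D i * z (VX i)) + real (budget D) * z (VPi l)
        + (\<Sum>i\<in>Items D. z (VRho i l))
        + real (selsize D) * alpha D l + (real (selsize D) - real (recov D)) * beta D l
        - (\<Sum>i\<in>Items D. hinge (alpha D l - lo D i) (beta D l) (z (VX i))) \<le> z VLambda"
      using z l(1) by (auto simp: prog_feasible_def)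
    with * show ?thesis using xz l by simp
  qed
  then show ?thesis using m by (simp add: rrec_obj_def inner_def x_def)
qed

text \<open>Fill \<open>\<pi>\<close> and \<open>\<rho>\<close> with optimal budget duals, one pair
  per breakpoint. Each selected \<open>Q l\<close> is then a scenario, and weak duality bounds its
  dual value by the worst-case recovery cost.\<close>

lemma prog_attains_rrec_obj:
  assumes v: "valid D" and x: "x \<in> Phi D"
  shows "\<exists>z\<in>prog_feasible D hinge. x_part D z = x \<and> z VLambda = rrec_obj D x"
proof -
  define inner where "inner c = Min ((\<lambda>y. \<Sum>i\<in>Items D. c i * y i) ` Phi_recov D x)" for c
  have "\<forall>l. \<exists>Q \<pi> \<rho>. Q \<subseteq> Items D \<and> card Q \<le> budget D \<and> \<pi> \<ge> 0 \<and> (\<forall>i\<in>Items D. \<rho> i \<ge> 0) \<and>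
    (\<forall>i\<in>Items D. \<pi> + \<rho> i \<ge> gain D x (alpha D l) (beta D l) i) \<and>
    real (budget D) * \<pi> + (\<Sum>i\<in>Items D. \<rho> i) = (\<Sum>i\<in>Q. gain D x (alpha D l) (beta D l) i)"
    using gain_nonneg[OF v] by (intro allI budget_dual_attained) auto
  then obtain Q \<pi> \<rho> where
    QP: "\<And>l. Q l \<subseteq> Items D \<and> card (Q l) \<le> budget D \<and> \<pi> l \<ge> 0 \<and> (\<forall>i\<in>Items D. \<rho> l i \<ge> 0) \<and>
    (\<forall>i\<in>Items D. \<pi> l + \<rho> l i \<ge> gain D x (alpha D l) (beta D l) i) \<and>
    real (budget D) * \<pi> l + (\<Sum>i\<in>Items D. \<rho> l i) = (\<Sum>i\<in>Q l. gain D x (alpha D l) (beta D l) i)"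
    by metis
  define z where "z = restrict (\<lambda>u. case u of VLambda \<Rightarrow> rrec_obj D x | VX i \<Rightarrow> x i | VPi l \<Rightarrow> \<pi> l
    | VRho i l \<Rightarrow> \<rho> l i) (prog_vars D)"
  have zs: "z VLambda = rrec_obj D x" "\<And>i. i \<in> Items D \<Longrightarrow> z (VX i) = x i"
    "\<And>l. l \<in> Points D \<Longrightarrow> z (VPi l) = \<pi> l"
    "\<And>i l. i \<in> Items D \<Longrightarrow> l \<in> Points D \<Longrightarrow> z (VRho i l) = \<rho> l i"
    by (auto simp: z_def prog_vars_def)
  have epi: "(\<Sum>i\<in>Items D. first_cost D i * x i) + real (budget D) * \<pi> l
        + (\<Sum>i\<in>Items D. \<rho> l i)
        + real (selsize D) * alpha D l + (real (selsize D) - real (recov D)) * beta D l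
        - (\<Sum>i\<in>Items D. hinge (alpha D l - lo D i) (beta D l) (x i)) \<le> rrec_obj D x"
    if "l \<in> Points D" for l
  proof -
    have "(alpha D l, beta D l) \<in> breakpoints D"
      using v that by (auto simp: valid_def bij_betw_def)
    then have b: "beta D l \<ge> 0" by (rule breakpoints_snd_nonneg)
    have Ql: "Q l \<subseteq> Items D" "card (Q l) \<le> budget D" using QP by auto
    have "dual_val D x (scen D (Q l)) (alpha D l) (beta D l) \<le> inner (scen D (Q l))"
      unfolding inner_def using finite_Phi_recov Phi_recov_nonempty[OF x] dual_val_le[OF _ b]
      by (subst Min_ge_iff) auto
    also have "\<dots> \<le> Max (inner ` Ud D)"
      using Ql finite_Ud by (intro Max_ge) (auto simp: Ud_eq)
    finally show ?thesis
      using QP[of l] unfolding dual_val_scen[OF Ql(1)] rrec_obj_def inner_def by simp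
  qed
  have "(\<Sum>i\<in>Items D. z (VX i)) = real (selsize D)" "\<forall>i\<in>Items D. z (VX i) \<in> {0, 1}"
    using x zs(2) by (auto simp: Phi_def PiE_def Pi_def)
  moreover have "z \<in> prog_vars D \<rightarrow>\<^sub>E UNIV" by (simp add: z_def)
  ultimately have "z \<in> prog_feasible D hinge"
    unfolding prog_feasible_def using epi QP by (simp add: zs gain_def)
  moreover have "x_part D z = x"
    using x zs(2) by (auto simp: x_part_def Phi_def PiE_def extensional_def restrict_def)
  ultimately show ?thesis using zs(1) by blast
qed

text \<open>The feasible set is infinite, so the minimum is transferred from the finite set
  \<open>Phi D\<close>.\<close>

lemma ex_prog_optimum:
  assumes "valid D"
  shows "\<exists>z. is_arg_min (\<lambda>z. z VLambda) (\<lambda>z. z \<in> prog_feasible D hinge) z"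
proof -
  have "rrec_value D \<in> rrec_obj D ` Phi D"
    unfolding rrec_value_def using finite_Phi Phi_nonempty[OF assms] by (intro Min_in) auto
  then obtain x where x: "x \<in> Phi D" "rrec_obj D x = rrec_value D" by auto
  obtain z where z: "z \<in> prog_feasible D hinge" "z VLambda = rrec_value D"
    using prog_attains_rrec_obj[OF assms x(1)] x(2) by auto
  have "rrec_value D \<le> z' VLambda" if "z' \<in> prog_feasible D hinge" for z'
  proof -
    have "rrec_value D \<le> rrec_obj D (x_part D z')"
      unfolding rrec_value_def using finite_Phi prog_feasible_x_part[OF that] by (intro Min_le) auto
    with rrec_obj_le[OF assms that] show ?thesis by simp
  qed
  with z show ?thesis by (auto simp: is_arg_min_linorder)
qed

text \<open>Squeeze: the optimal \<open>\<lambda>\<close> is at most \<open>rrec_obj D x\<close> for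
  every \<open>x\<close>, and at least that of its own \<open>x\<close>-part.\<close>

lemma prog_optimum:
  assumes v: "valid D" and z: "is_arg_min (\<lambda>z. z VLambda) (\<lambda>z. z \<in> prog_feasible D hinge) z"
  shows "z VLambda = rrec_value D \<and> is_arg_min (rrec_obj D) (\<lambda>x. x \<in> Phi D) (x_part D z)"
proof -
  have zf: "z \<in> prog_feasible D hinge"
    and zm: "\<And>z'. z' \<in> prog_feasible D hinge \<Longrightarrow> z VLambda \<le> z' VLambda"
    using z by (auto simp: is_arg_min_linorder)
  have le: "z VLambda \<le> rrec_obj D x" if "x \<in> Phi D" for x
    using prog_attains_rrec_obj[OF v that] zm by metis
  have xf: "x_part D z \<in> Phi D" by (rule prog_feasible_x_part[OF zf])
  have eq: "rrec_obj D (x_part D z) = z VLambda"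
    using rrec_obj_le[OF v zf] le[OF xf] by simp
  have "rrec_value D = z VLambda"
    unfolding rrec_value_def
  proof (rule Min_eqI)
    show "z VLambda \<in> rrec_obj D ` Phi D" using xf unfolding eq[symmetric] by (rule imageI)
  qed (use finite_Phi le in auto)
  then show ?thesis using eq le xf by (auto simp: is_arg_min_linorder)
qed


section \<open>The mixed integer linear program\<close>

lemma hinge_lin_eq: "t \<in> {0, 1} \<Longrightarrow> hinge_lin a b t = hinge a b t"
  by (auto simp: hinge_lin_def hinge_def)

text \<open>Both feasible sets force binary \<open>x\<close>, where a hinge term and its affine
  interpolant agree.\<close>

lemma prog_feasible_hinge_lin: "prog_feasible D hinge_lin = prog_feasible D hinge"
proof -
  have "z \<in> prog_feasible D hinge_lin \<longleftrightarrow> z \<in> prog_feasible D hinge"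
    if z: "\<forall>i\<in>Items D. z (VX i) \<in> {0, 1}" for z
  proof -
    have "(\<Sum>i\<in>Items D. hinge_lin (a i) b (z (VX i))) = (\<Sum>i\<in>Items D. hinge (a i) b (z (VX i)))"
      for a b
      using z by (intro sum.cong) (simp_all add: hinge_lin_eq)
    then show ?thesis unfolding prog_feasible_def using z by (simp add: hinge_lin_eq)
  qed
  moreover have "z \<in> prog_feasible D h \<Longrightarrow> \<forall>i\<in>Items D. z (VX i) \<in> {0, 1}" for z h
    unfolding prog_feasible_def by blast
  ultimately show ?thesis by blast
qed

lemma pair_image: "{f i l | i l. i \<in> A \<and> l \<in> B} = (\<lambda>(i, l). f i l) ` (A \<times> B)"
  by auto

lemma finite_prog_vars: "finite (prog_vars D)"
  unfolding prog_vars_def pair_image by auto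

lemma is_milp_rrec_milp: "is_milp (rrec_milp D)"
  unfolding is_milp_def rrec_milp_def pair_image using finite_prog_vars
  by (auto simp: prog_vars_def)

lemma sum_prog_vars:
  "(\<Sum>v\<in>prog_vars D. f v) = f VLambda + (\<Sum>i\<in>Items D. f (VX i)) + (\<Sum>l\<in>Points D. f (VPi l))
     + (\<Sum>i\<in>Items D. \<Sum>l\<in>Points D. f (VRho i l))" for f :: "prog_var \<Rightarrow> real"
proof -
  have "(\<Sum>v\<in>prog_vars D. f v) = (\<Sum>v\<in>{VLambda}. f v) + (\<Sum>v\<in>VX ` Items D. f v)
      + (\<Sum>v\<in>VPi ` Points D. f v) + (\<Sum>v\<in>(\<lambda>(i, l). VRho i l) ` (Items D \<times> Points D). f v)"
    unfolding prog_vars_def pair_image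
    by (subst sum.union_disjoint; (auto; fail)?)+
  also have "(\<Sum>v\<in>VX ` Items D. f v) = (\<Sum>i\<in>Items D. f (VX i))"
    by (subst sum.reindex) (auto simp: inj_on_def)
  also have "(\<Sum>v\<in>VPi ` Points D. f v) = (\<Sum>l\<in>Points D. f (VPi l))"
    by (subst sum.reindex) (auto simp: inj_on_def)
  also have "(\<Sum>v\<in>(\<lambda>(i, l). VRho i l) ` (Items D \<times> Points D). f v)
      = (\<Sum>i\<in>Items D. \<Sum>l\<in>Points D. f (VRho i l))"
    by (subst sum.reindex) (auto simp: inj_on_def sum.cartesian_product case_prod_unfold)
  finally show ?thesis by simp
qed

lemma sum_delta_mult:
  fixes f :: "'a \<Rightarrow> real"
  assumes "finite A" "a \<in> A"
  shows "(\<Sum>v\<in>A. (if v = a then t else 0) * f v) = t * f a"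
proof -
  have "(\<Sum>v\<in>A. (if v = a then t else 0) * f v) = (\<Sum>v\<in>A. if v = a then t * f v else 0)"
    by (intro sum.cong) auto
  then show ?thesis using assms by simp
qed

lemma row_Epi:
  assumes "l \<in> Points D"
  shows "(\<Sum>v\<in>prog_vars D. rrec_coef D (Epi l) v * z v) \<ge> rrec_rhs D (Epi l) \<longleftrightarrow>
    z VLambda \<ge> (\<Sum>i\<in>Items D. first_cost D i * z (VX i)) + real (budget D) * z (VPi l)
        + (\<Sum>i\<in>Items D. z (VRho i l))
        + real (selsize D) * alpha D l + (real (selsize D) - real (recov D)) * beta D l
        - (\<Sum>i\<in>Items D. hinge_lin (alpha D l - lo D i) (beta D l) (z (VX i)))"
proof -
  have "(\<Sum>v\<in>prog_vars D. rrec_coef D (Epi l) v * z v) = z VLambda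
     + (\<Sum>i\<in>Items D. (slope (alpha D l - lo D i) (beta D l) - first_cost D i) * z (VX i))
     + - real (budget D) * z (VPi l) + (\<Sum>i\<in>Items D. - 1 * z (VRho i l))"
    unfolding sum_prog_vars rrec_coef.simps prog_var.case
    using assms by (simp only: sum_delta_mult finite_atLeastAtMost)
  then show ?thesis
    by (auto simp: hinge_lin_def slope_def algebra_simps sum.distrib sum_subtractf sum_negf)
qed

lemma row_Cover:
  assumes "i \<in> Items D" "l \<in> Points D"
  shows "(\<Sum>v\<in>prog_vars D. rrec_coef D (Cover i l) v * z v) \<ge> rrec_rhs D (Cover i l) \<longleftrightarrow>
    z (VPi l) + z (VRho i l) \<ge>
        hinge_lin (alpha D l - lo D i) (beta D l) (z (VX i))
        - hinge_lin (alpha D l - lo D i - dev D i) (beta D l) (z (VX i))"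
proof -
  define s where "s = slope (alpha D l - lo D i - dev D i) (beta D l)
    - slope (alpha D l - lo D i) (beta D l)"
  \<comment> \<open>The three variables of the row are distinct, so its coefficient is a sum of
    three single-variable indicators.\<close>
  have "(\<Sum>v\<in>prog_vars D. rrec_coef D (Cover i l) v * z v)
    = (\<Sum>v\<in>prog_vars D. (if v = VPi l then 1 else 0) * z v + (if v = VRho i l then 1 else 0) * z v
        + (if v = VX i then s else 0) * z v)"
    by (intro sum.cong) (auto simp: s_def)
  also have "\<dots> = z (VPi l) + z (VRho i l) + s * z (VX i)"
    unfolding sum.distrib
    using assms by (subst (1 2 3) sum_delta_mult[OF finite_prog_vars]) (auto simp: prog_vars_def)
  finally show ?thesis by (auto simp: s_def hinge_lin_def slope_def algebra_simps)
qed

lemma row_Card: "(\<Sum>v\<in>prog_vars D. rrec_coef D Card v * z v) = (\<Sum>i\<in>Items D. z (VX i))"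
  unfolding sum_prog_vars by simp

lemma row_bounds:
  shows "i \<in> Items D \<Longrightarrow> (\<Sum>v\<in>prog_vars D. rrec_coef D (XLower i) v * z v) = z (VX i)"
    and "i \<in> Items D \<Longrightarrow> (\<Sum>v\<in>prog_vars D. rrec_coef D (XUpper i) v * z v) = z (VX i)"
    and "i \<in> Items D \<Longrightarrow> l \<in> Points D \<Longrightarrow>
      (\<Sum>v\<in>prog_vars D. rrec_coef D (RhoSign i l) v * z v) = z (VRho i l)"
    and "l \<in> Points D \<Longrightarrow> (\<Sum>v\<in>prog_vars D. rrec_coef D (PiSign l) v * z v) = z (VPi l)"
  unfolding rrec_coef.simps
  by (subst sum_delta_mult[OF finite_prog_vars]; auto simp: prog_vars_def)+

lemma binary_iff: "t \<in> {0, 1} \<longleftrightarrow> t \<in> \<int> \<and> 0 \<le> t \<and> t \<le> 1" for t :: real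
proof
  assume t: "t \<in> \<int> \<and> 0 \<le> t \<and> t \<le> 1"
  then obtain m where m: "t = of_int m" by (auto elim: Ints_cases)
  then have "m = 0 \<or> m = 1" using t by auto
  then show "t \<in> {0, 1}" using m by auto
qed auto

lemma milp_feasible_rrec_milp:
  assumes "valid D"
  shows "milp_feasible (rrec_milp D) = prog_feasible D hinge_lin"
proof (rule set_eqI)
  fix z
  \<comment> \<open>The sign of \<open>\<pi>\<close> is one row per breakpoint in the linear program
    but one condition per item and breakpoint in the original; they match because an item
    exists.\<close>
  have ne: "\<exists>i. i \<in> Items D" using assms by (auto simp: valid_def)
  have "z \<in> milp_feasible (rrec_milp D) \<longleftrightarrow> z \<in> prog_vars D \<rightarrow>\<^sub>E UNIV \<and>
    (\<forall>i\<in>Items D. z (VX i) \<in> \<int>) \<and>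
    (\<forall>l\<in>Points D. (\<Sum>v\<in>prog_vars D. rrec_coef D (Epi l) v * z v) \<ge> rrec_rhs D (Epi l)) \<and>
    (\<forall>i\<in>Items D. \<forall>l\<in>Points D.
      (\<Sum>v\<in>prog_vars D. rrec_coef D (Cover i l) v * z v) \<ge> rrec_rhs D (Cover i l)) \<and>
    (\<Sum>v\<in>prog_vars D. rrec_coef D Card v * z v) = real (selsize D) \<and>
    (\<forall>i\<in>Items D. (\<Sum>v\<in>prog_vars D. rrec_coef D (XLower i) v * z v) \<ge> 0) \<and>
    (\<forall>i\<in>Items D. (\<Sum>v\<in>prog_vars D. rrec_coef D (XUpper i) v * z v) \<le> 1) \<and>
    (\<forall>i\<in>Items D. \<forall>l\<in>Points D.
      (\<Sum>v\<in>prog_vars D. rrec_coef D (RhoSign i l) v * z v) \<ge> 0) \<and>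
    (\<forall>l\<in>Points D. (\<Sum>v\<in>prog_vars D. rrec_coef D (PiSign l) v * z v) \<ge> 0)"
    unfolding milp_feasible_def rrec_milp_def pair_image milp.simps
    by (simp add: ball_Un ball_simps(9) del: rrec_coef.simps atLeastAtMost_iff rrec_rhs.simps(1,2))
      (simp del: rrec_coef.simps atLeastAtMost_iff; blast)
  also have "\<dots> \<longleftrightarrow> z \<in> prog_feasible D hinge_lin"
    unfolding prog_feasible_def mem_Collect_eq binary_iff row_Card
    by (simp add: row_Epi row_Cover row_bounds ball_conj_distrib ne
        del: rrec_coef.simps rrec_rhs.simps atLeastAtMost_iff One_nat_def) blast
  finally show "z \<in> milp_feasible (rrec_milp D) \<longleftrightarrow> z \<in> prog_feasible D hinge_lin" .
qed

lemma milp_obj_rrec_milp: "milp_obj (rrec_milp D) z = z VLambda"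
  unfolding milp_obj_def rrec_milp_def milp.simps
  by (subst sum_delta_mult[OF finite_prog_vars]) (auto simp: prog_vars_def)


section \<open>Size of the program\<close>

text \<open>Clamping puts all candidate values into a pool of at most \<open>2 * n\<close> sorted
  bounds; single values and pairs give at most \<open>2 * n + (2 * n)^2 \<le> 6 * n^2\<close>
  breakpoints.\<close>

lemma card_breakpoints_le:
  assumes "valid D"
  shows "card (breakpoints D) \<le> 6 * items D ^ 2"
proof -
  define n where "n = items D"
  define V where "V = lo_sorted D ` {1..n} \<union> hi_sorted D ` {1..n}"
  have n: "1 \<le> n" using assms by (auto simp: valid_def n_def)
  have finV: "finite V" by (simp add: V_def)
  have "card V \<le> card (lo_sorted D ` {1..n}) + card (hi_sorted D ` {1..n})"
    unfolding V_def by (rule card_Un_le)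
  also have "\<dots> \<le> n + n" by (intro add_mono order.trans[OF card_image_le]) auto
  finally have cV: "card V \<le> 2 * n" by simp
  have lo: "lo_sorted D j \<in> V" for j
  proof -
    have "lo_sorted D j = lo_sorted D (max 1 (min n j))" using n by (simp add: lo_sorted_def n_def)
    moreover have "max 1 (min n j) \<in> {1..n}" using n by auto
    ultimately show ?thesis unfolding V_def by blast
  qed
  \<comment> \<open>Upper-bound indices are clamped only from above, so index 0 is excluded; all
    three lists of upper bounds start at 1.\<close>
  have hi: "hi_sorted D j \<in> V" if "1 \<le> j" for j
  proof -
    have "hi_sorted D j = hi_sorted D (min n j)" by (simp add: hi_sorted_def n_def)
    moreover have "min n j \<in> {1..n}" using n that by auto
    ultimately show ?thesis unfolding V_def by blast
  qed
  have C: "C_p D \<subseteq> V" "C_pk D \<subseteq> V" "C_k D \<subseteq> V"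
    using lo hi by (auto simp: C_p_def C_pk_def C_k_def)
  have "breakpoints D \<subseteq> (\<lambda>u. (u, 0)) ` V \<union> (\<lambda>(v, w). (w, v - w)) ` (V \<times> V)"
    unfolding breakpoints_def using C by force
  then have "card (breakpoints D) \<le> card ((\<lambda>u. (u, 0::real)) ` V \<union> (\<lambda>(v, w). (w, v - w)) ` (V \<times> V))"
    using finV by (intro card_mono) auto
  also have "\<dots> \<le> card ((\<lambda>u. (u, 0::real)) ` V) + card ((\<lambda>(v, w). (w, v - w)) ` (V \<times> V))"
    by (rule card_Un_le)
  also have "\<dots> \<le> card V + card V * card V"
    using finV by (intro add_mono order.trans[OF card_image_le]) (auto simp: card_cartesian_product)
  also have "\<dots> \<le> 2 * n + 2 * n * (2 * n)" using cV by (intro add_mono mult_le_mono) auto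
  also have "\<dots> \<le> 6 * n ^ 2" using n by (simp add: power2_eq_square)
  finally show ?thesis by (simp add: n_def)
qed

lemma card_prog_vars_le:
  "card (prog_vars D) \<le> 1 + items D + card (breakpoints D) + items D * card (breakpoints D)"
proof -
  \<comment> \<open>Counting as a sum of ones reuses the split of the variables by kind.\<close>
  have "real (card (prog_vars D)) = (\<Sum>v\<in>prog_vars D. 1)" by simp
  also have "\<dots> = real (1 + items D + card (breakpoints D) + items D * card (breakpoints D))"
    unfolding sum_prog_vars by simp
  finally show ?thesis by linarith
qed

lemma card_Un_le_add: "card A \<le> a \<Longrightarrow> card B \<le> b \<Longrightarrow> card (A \<union> B) \<le> a + b"
  by (meson add_mono card_Un_le order.trans)

lemma card_image_le_card: "finite A \<Longrightarrow> card A \<le> m \<Longrightarrow> card (f ` A) \<le> m"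
  by (meson card_image_le order.trans)

lemma card_milp_rows_le:
  "card (milp_rows (rrec_milp D)) \<le> card (breakpoints D) + items D * card (breakpoints D) + 1
     + items D + items D + items D * card (breakpoints D) + card (breakpoints D)"
  unfolding rrec_milp_def pair_image milp.simps
  by (intro card_Un_le_add card_image_le_card) (auto simp: card_cartesian_product)

lemma eventually_valid: "eventually valid large_instances"
  unfolding large_instances_def going_to_within_def eventually_inf_principal by simp

lemma bigo_large_instances:
  fixes f :: "rrs \<Rightarrow> nat"
  assumes "\<And>D. valid D \<Longrightarrow> f D \<le> K * items D ^ 3"
  shows "(\<lambda>D. real (f D)) \<in> O[large_instances](\<lambda>D. real (items D) ^ 3)"
proof (rule bigoI[of _ "real K"])
  show "eventually (\<lambda>D. norm (real (f D)) \<le> real K * norm (real (items D) ^ 3)) large_instances"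
    using eventually_valid
  proof eventually_elim
    case (elim D)
    have "real (f D) \<le> real (K * items D ^ 3)" using assms[OF elim] by linarith
    then show ?case by simp
  qed
qed

lemma
  assumes v: "valid D"
  shows card_milp_vars_cubic: "card (milp_vars (rrec_milp D)) \<le> 14 * items D ^ 3"
    and card_milp_rows_cubic: "card (milp_rows (rrec_milp D)) \<le> 27 * items D ^ 3"
proof -
  define n where "n = items D"
  define S where "S = card (breakpoints D)"
  have n: "1 \<le> n" using v by (auto simp: valid_def n_def)
  have S: "S \<le> 6 * n ^ 2" using card_breakpoints_le[OF v] by (simp add: S_def n_def)
  \<comment> \<open>Each of \<open>1\<close>, \<open>n\<close> and \<open>n ^ 2\<close> is at most
    \<open>n ^ 3\<close>, so the coefficients add up to 1 + 1 + 6 + 6 = 14 for variables and 4 * 6 +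
    3 = 27 for rows.\<close>
  have p: "1 \<le> n ^ 3" "n \<le> n ^ 3" "n ^ 2 \<le> n ^ 3"
    using n power_increasing[of 1 3 n] power_increasing[of 2 3 n] by auto
  have "n * S \<le> n * (6 * n ^ 2)" using S by (rule mult_le_mono2)
  then have nS: "n * S \<le> 6 * n ^ 3" by (simp add: power2_eq_square power3_eq_cube)
  have "milp_vars (rrec_milp D) = prog_vars D" by (simp add: rrec_milp_def)
  then show "card (milp_vars (rrec_milp D)) \<le> 14 * items D ^ 3"
    using card_prog_vars_le[of D, folded n_def S_def] S nS p unfolding n_def[symmetric] by simp
  show "card (milp_rows (rrec_milp D)) \<le> 27 * items D ^ 3"
    using card_milp_rows_le[of D, folded n_def S_def] S nS p unfolding n_def[symmetric] by linarith
qed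

theorem mainTheorem8:
  shows
    "(\<forall>D. valid D \<longrightarrow>
        (\<exists>z. is_arg_min (\<lambda>z. z VLambda) (\<lambda>z. z \<in> prog_feasible D hinge) z) \<and>
        (\<forall>z. is_arg_min (\<lambda>z. z VLambda) (\<lambda>z. z \<in> prog_feasible D hinge) z \<longrightarrow>
           z VLambda = rrec_value D \<and>
           is_arg_min (rrec_obj D) (\<lambda>x. x \<in> Phi D) (x_part D z)) \<and>
        prog_feasible D hinge_lin = prog_feasible D hinge \<and>
        is_milp (rrec_milp D) \<and>
        milp_feasible (rrec_milp D) = prog_feasible D hinge_lin \<and>
        (\<forall>z\<in>prog_feasible D hinge_lin. milp_obj (rrec_milp D) z = z VLambda)) \<and>
     (\<lambda>D. real (card (milp_vars (rrec_milp D)))) \<in> O[large_instances](\<lambda>D. real (items D) ^ 3) \<and>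
     (\<lambda>D. real (card (milp_rows (rrec_milp D)))) \<in> O[large_instances](\<lambda>D. real (items D) ^ 3)"
  using ex_prog_optimum prog_optimum prog_feasible_hinge_lin is_milp_rrec_milp
    milp_feasible_rrec_milp milp_obj_rrec_milp
    bigo_large_instances[OF card_milp_vars_cubic] bigo_large_instances[OF card_milp_rows_cubic]
  by blast

end
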